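(* The forgetful morphism $\imath:\mathcal{Q}(r,n)\to\mathcal{A}(r,n)$ is proper.
   Context: Fix $V_\infty=\mathbb{C}^r$ with basis $e_a$ and $A_re_a=e_{a+1}$, $e_{r+1}=0$. $\mathcal{Q}(r,n)$ is the fine moduli space of framed cyclic representations $(V,B_1,B_2,B_3,I,J)$ up to $GL(V)$. These have $\dim V=n$ and satisfy $[B_1,B_2]+IJ=0$, $JB_3=A_rJ$, $B_3I=IA_r$ and $[B_3,B_i]=0$ for $i=1,2$; moreover no proper nonzero $B_1,B_2,B_3$-invariant subspace contains $\mathrm{Im}\,I$. $\mathcal{A}(r,n)$ is the fine moduli space of stable ADHM data $(V,B_1,B_2,I,J)$ with $[B_1,B_2]+IJ=0$ and no proper $B_1,B_2$-invariant subspace containing $\mathrm{Im}\,I$. The map $\imath$ forgets $B_3$. *)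

theory Defs
  imports "HOL-Analysis.Analysis"
begin

text \<open>Complex linear subspaces of a coordinate space (closed under complex scalars).\<close>
definition csubspace :: "(complex^'n) set \<Rightarrow> bool" where
  "csubspace S \<longleftrightarrow> 0 \<in> S \<and> (\<forall>x\<in>S. \<forall>y\<in>S. x + y \<in> S) \<and> (\<forall>c. \<forall>x\<in>S. c *s x \<in> S)"

text \<open>The nilpotent shift A_r on V_infinity = C^r: the basis is indexed by a finite
  linearly ordered type 'r (e_1 < ... < e_r), and A_r e_a = e_(a+1), A_r e_r = 0.
  Entry (i,j) is 1 iff i is the immediate successor of j.\<close>
definition shiftA :: "complex^('r::{finite,linorder})^('r::{finite,linorder})" where
  "shiftA = (\<chi> i j. if j < i \<and> (\<forall>k. j < k \<longrightarrow> i \<le> k) then 1 else 0)"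

type_synonym ('n,'r) adhm =
  "(complex^'n^'n) \<times> (complex^'n^'n) \<times> (complex^'r^'n) \<times> (complex^'n^'r)"
type_synonym ('n,'r) cyc =
  "(complex^'n^'n) \<times> (complex^'n^'n) \<times> (complex^'n^'n) \<times> (complex^'r^'n) \<times> (complex^'n^'r)"

definition invariant_under :: "(complex^'n) set \<Rightarrow> complex^'n^'n \<Rightarrow> bool" where
  "invariant_under S B \<longleftrightarrow> (\<forall>x\<in>S. B *v x \<in> S)"

text \<open>Stable ADHM data: [B1,B2]+IJ=0 and no proper B1,B2-invariant subspace contains Im I.\<close>
definition stable_adhm :: "('n::finite,'r::finite) adhm set" where
  "stable_adhm = {(B1,B2,I,J). B1 ** B2 - B2 ** B1 + I ** J = 0 \<and>
     (\<forall>S. csubspace S \<and> invariant_under S B1 \<and> invariant_under S B2 \<and> range ((*v) I) \<subseteq> S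
          \<longrightarrow> S = UNIV)}"

text \<open>Stable framed cyclic data.\<close>
definition stable_cyc :: "('n::finite,'r::{finite,linorder}) cyc set" where
  "stable_cyc = {(B1,B2,B3,I,J). B1 ** B2 - B2 ** B1 + I ** J = 0 \<and>
     J ** B3 = shiftA ** J \<and> B3 ** I = I ** shiftA \<and>
     B3 ** B1 = B1 ** B3 \<and> B3 ** B2 = B2 ** B3 \<and>
     (\<forall>S. csubspace S \<and> invariant_under S B1 \<and> invariant_under S B2 \<and> invariant_under S B3
          \<and> range ((*v) I) \<subseteq> S \<longrightarrow> S = UNIV)}"

text \<open>GL(V)-orbit relations: g.(B,I,J) = (g B g^-1, g I, J g^-1).\<close>
definition adhm_rel :: "(('n::finite,'r::finite) adhm \<times> ('n,'r) adhm) set" where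
  "adhm_rel = {((B1,B2,I,J),(B1',B2',I',J')). (B1,B2,I,J) \<in> stable_adhm \<and> (B1',B2',I',J') \<in> stable_adhm \<and>
     (\<exists>g h :: complex^'n^'n. g ** h = mat 1 \<and> h ** g = mat 1 \<and>
        B1' = g ** B1 ** h \<and> B2' = g ** B2 ** h \<and> I' = g ** I \<and> J' = J ** h)}"

definition cyc_rel :: "(('n::finite,'r::{finite,linorder}) cyc \<times> ('n,'r) cyc) set" where
  "cyc_rel = {((B1,B2,B3,I,J),(B1',B2',B3',I',J')). (B1,B2,B3,I,J) \<in> stable_cyc \<and> (B1',B2',B3',I',J') \<in> stable_cyc \<and>
     (\<exists>g h :: complex^'n^'n. g ** h = mat 1 \<and> h ** g = mat 1 \<and>
        B1' = g ** B1 ** h \<and> B2' = g ** B2 ** h \<and> B3' = g ** B3 ** h \<and> I' = g ** I \<and> J' = J ** h)}"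

text \<open>Quotient topology on the set of equivalence classes S // R, S carrying the
  subspace topology of the ambient Euclidean topology.\<close>
definition quot_top :: "'a::topological_space set \<Rightarrow> ('a \<times> 'a) set \<Rightarrow> 'a set topology" where
  "quot_top S R = topology (\<lambda>U. U \<subseteq> S // R \<and> openin (top_of_set S) (\<Union>U))"

text \<open>Moduli spaces (as topological spaces of GL(V)-orbits, classical topology).\<close>
definition Qmod :: "('n::finite,'r::{finite,linorder}) cyc set topology" where
  "Qmod = quot_top stable_cyc cyc_rel"

definition Amod :: "('n::finite,'r::finite) adhm set topology" where
  "Amod = quot_top stable_adhm adhm_rel"

definition forget :: "('n,'r) cyc \<Rightarrow> ('n,'r) adhm" where
  "forget = (\<lambda>(B1,B2,B3,I,J). (B1,B2,I,J))"

text \<open>The forgetful morphism on orbits: the image of a GL(V)-orbit under forget.\<close>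
definition iota :: "('n,'r) cyc set \<Rightarrow> ('n,'r) adhm set" where
  "iota c = forget ` c"

end

theory Submission
  imports Defs
begin

text \<open>A cyclic datum is an ADHM datum together with an endomorphism \<open>B3\<close> commuting with
  \<open>B1\<close>, \<open>B2\<close> and intertwining \<open>I\<close>, \<open>J\<close> with the shift \<open>A\<^sub>r\<close>. The vectors
  \<open>B\<^sub>w I v\<close>, for words \<open>w\<close> in \<open>B1\<close>, \<open>B2\<close>, span the smallest \<open>B1,B2\<close>-invariant subspace
  containing \<open>Im I\<close>, and \<open>B3 B\<^sub>w I v = B\<^sub>w I (A\<^sub>r v)\<close> makes it \<open>B3\<close>-invariant as well.
  Hence a cyclic datum is stable iff its ADHM datum is, and then \<open>B3\<close> is determined by the
  ADHM datum. Choosing \<open>n\<close> of these vectors that form a basis at a point, Cramer's rule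
  expresses \<open>B3\<close> as a continuous function of the ADHM datum near that point, so forgetting
  \<open>B3\<close> maps closed sets of stable cyclic data to closed sets of stable ADHM data. It is
  also injective and \<open>GL(V)\<close>-equivariant, and \<open>GL(V)\<close>-translates of its values lift, so
  on orbit spaces \<open>iota\<close> is closed and injective, hence proper.\<close>

section \<open>Continuity of matrix operations\<close>

lemma continuous_on_matrix_mult [continuous_intros]:
  fixes F :: "'a::topological_space \<Rightarrow> 'b::real_normed_algebra_1^'m^'n"
    and G :: "'a \<Rightarrow> 'b^'p^'m"
  assumes "continuous_on S F" "continuous_on S G"
  shows "continuous_on S (\<lambda>x. F x ** G x)"
  unfolding matrix_matrix_mult_def
  by (intro continuous_on_vec_lambda continuous_on_sum continuous_on_mult
      continuous_on_component assms)

lemma continuous_on_matrix_vector_mult [continuous_intros]: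
  fixes F :: "'a::topological_space \<Rightarrow> 'b::real_normed_algebra_1^'m^'n"
    and G :: "'a \<Rightarrow> 'b^'m"
  assumes "continuous_on S F" "continuous_on S G"
  shows "continuous_on S (\<lambda>x. F x *v G x)"
  unfolding matrix_vector_mult_def
  by (intro continuous_on_vec_lambda continuous_on_sum continuous_on_mult
      continuous_on_component assms)

lemma continuous_on_det [continuous_intros]:
  fixes F :: "'a::topological_space \<Rightarrow> 'b::real_normed_field^'n^'n"
  assumes "continuous_on S F"
  shows "continuous_on S (\<lambda>x. det (F x))"
  unfolding det_def
  by (intro continuous_on_sum continuous_on_mult continuous_on_const continuous_on_prod
      continuous_on_component assms)

text \<open>Cramer's rule for the solution \<open>X\<close> of \<open>X ** M = N\<close>; unlike \<open>matrix_inv\<close>, it is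
  visibly continuous in \<open>M\<close> and \<open>N\<close> where \<open>det M \<noteq> 0\<close>.\<close>

definition matrix_right_quotient :: "'a::field^'n^'m \<Rightarrow> 'a^'n^'n \<Rightarrow> 'a^'n^'m" where
  "matrix_right_quotient N M =
     (\<chi> i k. det (\<chi> r j. if j = k then N $ i $ r else M $ j $ r) / det M)"

lemma matrix_right_quotient_unique:
  fixes M :: "'a::field^'n^'n"
  assumes "det M \<noteq> 0" "X ** M = N"
  shows "X = matrix_right_quotient N M"
proof -
  have "det (transpose M) \<noteq> 0"
    using assms(1) by (simp add: det_transpose)
  moreover have "transpose M *v X $ i = N $ i" for i
    using assms(2) by (auto simp: vec_eq_iff matrix_matrix_mult_def matrix_vector_mult_def
        transpose_def mult.commute)
  ultimately have "X $ i = (\<chi> k. det (\<chi> r j. if j = k then N $ i $ r else transpose M $ r $ j)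
      / det (transpose M))" for i
    using cramer by blast
  then show ?thesis
    unfolding det_transpose
    by (simp add: vec_eq_iff matrix_right_quotient_def transpose_def cong: if_cong)
qed

lemma continuous_on_matrix_right_quotient [continuous_intros]:
  fixes M :: "'a::topological_space \<Rightarrow> 'b::real_normed_field^'n^'n"
    and N :: "'a \<Rightarrow> 'b^'n^'m"
  assumes "continuous_on S N" "continuous_on S M" "\<And>x. x \<in> S \<Longrightarrow> det (M x) \<noteq> 0"
  shows "continuous_on S (\<lambda>x. matrix_right_quotient (N x) (M x))"
  unfolding matrix_right_quotient_def
proof (intro continuous_on_vec_lambda continuous_on_divide continuous_on_det ballI assms(3))
  show "continuous_on S (\<lambda>x. if j = k then N x $ i $ r else M x $ j $ r)" for i k r j
    by (cases "j = k") (simp_all add: continuous_on_component assms(1,2))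
qed (use assms in auto)

section \<open>Linear algebra and topology\<close>

lemma spanning_family_obtains_invertible_matrix:
  fixes v :: "'i \<Rightarrow> 'a::field^'n"
  assumes "vec.span (range v) = UNIV"
  obtains f :: "'n \<Rightarrow> 'i" where "det (\<chi> i c. v (f c) $ i) \<noteq> 0"
proof -
  obtain B where B: "B \<subseteq> range v" "vec.independent B" "range v \<subseteq> vec.span B"
    by (rule vec.maximal_independent_subset)
  have span_B: "vec.span B = UNIV"
    using vec.span_mono[OF B(3)] assms by (auto simp: vec.span_span)
  have "card B = vec.dim (UNIV :: ('a^'n) set)"
    using vec.basis_card_eq_dim[of B UNIV] B(2) span_B by simp
  then have "card B = CARD('n)"
    by (simp only: vec_dim_card)
  then obtain h where h: "bij_betw h (UNIV :: 'n set) B"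
    using finite_same_card_bij[of "UNIV :: 'n set" B] vec.finiteI_independent[OF B(2)] by auto
  then have h_range: "h c \<in> range v" for c
    using B(1) bij_betwE by blast
  define f where "f c = inv v (h c)" for c
  let ?A = "\<chi> i c. v (f c) $ i"
  have col: "column c ?A = h c" for c
    using h_range by (simp add: column_def f_def f_inv_into_f)
  have "columns ?A = B"
    unfolding columns_def col using bij_betw_imp_surj_on[OF h] by blast
  then have "\<exists>X. ?A ** X = mat 1"
    by (simp only: matrix_right_invertible_span_columns span_B)
  then have "det ?A \<noteq> 0"
    by (simp add: invertible_det_nz flip: invertible_right_inverse)
  then show thesis
    by (rule that)
qed

lemma vec_subspace_iff_csubspace: "vec.subspace S \<longleftrightarrow> csubspace S"
  by (simp add: vec.subspace_def csubspace_def)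

lemma csubspace_span: "csubspace (vec.span S)"
  by (simp flip: vec_subspace_iff_csubspace)

lemma invariant_under_span:
  assumes "(*v) B ` V \<subseteq> V"
  shows "invariant_under (vec.span V) B"
  unfolding invariant_under_def
proof
  fix x assume "x \<in> vec.span V"
  then have "B *v x \<in> vec.span ((*v) B ` V)"
    by (simp add: vec.span_image)
  also have "\<dots> \<subseteq> vec.span V"
    using assms by (rule vec.span_mono)
  finally show "B *v x \<in> vec.span V" .
qed

lemma closedin_if_locally_closedin:
  assumes "T \<subseteq> topspace X"
    and "\<And>x. x \<in> topspace X - T \<Longrightarrow>
      \<exists>U. openin X U \<and> x \<in> U \<and> closedin (subtopology X U) (U \<inter> T)"
  shows "closedin X T"
proof -
  have "openin X (topspace X - T)"
  proof (subst openin_subopen, intro ballI)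
    fix x assume "x \<in> topspace X - T"
    then obtain U where U: "openin X U" "x \<in> U" "closedin (subtopology X U) (U \<inter> T)"
      using assms(2) by blast
    have "U \<subseteq> topspace X"
      using U(1) by (rule openin_subset)
    then have "openin (subtopology X U) (U - U \<inter> T)"
      using U(3) by (simp add: closedin_def inf_absorb2)
    then have "openin X (U - U \<inter> T)"
      using U(1) by (rule openin_trans_full)
    then show "\<exists>V. openin X V \<and> x \<in> V \<and> V \<subseteq> topspace X - T"
      using U(2) \<open>x \<in> topspace X - T\<close> \<open>U \<subseteq> topspace X\<close> by blast
  qed
  with assms(1) show ?thesis
    by (simp add: closedin_def)
qed

section \<open>Words in B1 and B2 applied to Im I\<close>

fun word_mat :: "'a::semiring_1^'n^'n \<Rightarrow> 'a^'n^'n \<Rightarrow> bool list \<Rightarrow> 'a^'n^'n" where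
  "word_mat B1 B2 [] = mat 1"
| "word_mat B1 B2 (b # w) = (if b then B2 else B1) ** word_mat B1 B2 w"

lemma continuous_on_word_mat [continuous_intros]:
  fixes F1 F2 :: "'a::topological_space \<Rightarrow> 'b::real_normed_algebra_1^'n^'n"
  assumes "continuous_on S F1" "continuous_on S F2"
  shows "continuous_on S (\<lambda>x. word_mat (F1 x) (F2 x) w)"
proof (induction w)
  case (Cons b w)
  then show ?case
    using assms by (cases b) (simp_all add: continuous_on_matrix_mult)
qed (simp add: continuous_on_const)

lemma word_mat_commute:
  assumes "C ** B1 = B1 ** C" "C ** B2 = B2 ** C"
  shows "C ** word_mat B1 B2 w = word_mat B1 B2 w ** C"
proof (induction w)
  case (Cons b w)
  let ?B = "if b then B2 else B1"
  have "C ** ?B = ?B ** C"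
    using assms by simp
  then have "C ** (?B ** word_mat B1 B2 w) = ?B ** (C ** word_mat B1 B2 w)"
    by (simp add: matrix_mul_assoc)
  also have "\<dots> = ?B ** word_mat B1 B2 w ** C"
    using Cons by (simp add: matrix_mul_assoc)
  finally show ?case
    by simp
qed simp

definition word_vec :: "('n::finite,'r::finite) adhm \<Rightarrow> bool list \<times> (complex^'r) \<Rightarrow> complex^'n"
  where "word_vec a p = (case a of (B1, B2, I, J) \<Rightarrow> word_mat B1 B2 (fst p) *v (I *v snd p))"

lemma word_vec_Nil: "word_vec (B1, B2, I, J) ([], v) = I *v v"
  by (simp add: word_vec_def)

lemma word_vec_Cons:
  "word_vec (B1, B2, I, J) (b # w, v) = (if b then B2 else B1) *v word_vec (B1, B2, I, J) (w, v)"
  by (simp add: word_vec_def matrix_vector_mul_assoc matrix_mul_assoc)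

lemma word_vec_in_invariant_subspace:
  assumes "invariant_under S B1" "invariant_under S B2" "range ((*v) I) \<subseteq> S"
  shows "word_vec (B1, B2, I, J) (w, v) \<in> S"
  using assms by (induction w) (auto simp: invariant_under_def word_vec_Nil word_vec_Cons)

lemma word_vec_span_minimal:
  assumes "csubspace S" "invariant_under S B1" "invariant_under S B2" "range ((*v) I) \<subseteq> S"
  shows "vec.span (range (word_vec (B1, B2, I, J))) \<subseteq> S"
  using assms word_vec_in_invariant_subspace
  by (intro vec.span_minimal) (auto simp: vec_subspace_iff_csubspace)

lemma word_vec_span_invariant:
  "invariant_under (vec.span (range (word_vec (B1, B2, I, J)))) B1"
  "invariant_under (vec.span (range (word_vec (B1, B2, I, J)))) B2"
proof -
  have "B1 *v word_vec (B1, B2, I, J) (w, v) = word_vec (B1, B2, I, J) (False # w, v)"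
    "B2 *v word_vec (B1, B2, I, J) (w, v) = word_vec (B1, B2, I, J) (True # w, v)" for w v
    by (simp_all add: word_vec_Cons)
  then show "invariant_under (vec.span (range (word_vec (B1, B2, I, J)))) B1"
    "invariant_under (vec.span (range (word_vec (B1, B2, I, J)))) B2"
    by (auto intro!: invariant_under_span)
qed

lemma range_subset_word_vec_span: "range ((*v) I) \<subseteq> vec.span (range (word_vec (B1, B2, I, J)))"
proof
  fix y assume "y \<in> range ((*v) I)"
  then obtain v where "y = word_vec (B1, B2, I, J) ([], v)"
    by (auto simp: word_vec_Nil)
  then show "y \<in> vec.span (range (word_vec (B1, B2, I, J)))"
    by (simp add: vec.span_base)
qed

lemma stable_adhm_word_vec_span:
  assumes "a \<in> stable_adhm"
  shows "vec.span (range (word_vec a)) = UNIV"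
proof -
  obtain B1 B2 I J where a: "a = (B1, B2, I, J)"
    by (cases a)
  have "\<forall>S. csubspace S \<and> invariant_under S B1 \<and> invariant_under S B2 \<and> range ((*v) I) \<subseteq> S
      \<longrightarrow> S = UNIV"
    using assms by (simp add: a stable_adhm_def)
  then show ?thesis
    using csubspace_span word_vec_span_invariant range_subset_word_vec_span unfolding a by blast
qed

section \<open>Stability of cyclic data\<close>

definition cyclic_eqs :: "('n::finite,'r::{finite,linorder}) cyc \<Rightarrow> bool" where
  "cyclic_eqs = (\<lambda>(B1, B2, B3, I, J). J ** B3 = shiftA ** J \<and> B3 ** I = I ** shiftA \<and>
     B3 ** B1 = B1 ** B3 \<and> B3 ** B2 = B2 ** B3)"

lemma word_vec_shift:
  assumes "cyclic_eqs (B1, B2, B3, I, J)"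
  shows "B3 *v word_vec (B1, B2, I, J) (w, v) = word_vec (B1, B2, I, J) (w, shiftA *v v)"
proof -
  have "B3 ** word_mat B1 B2 w ** I = word_mat B1 B2 w ** I ** shiftA"
    using assms word_mat_commute[of B3 B1 B2 w]
    by (simp add: cyclic_eqs_def) (metis matrix_mul_assoc)
  then show ?thesis
    by (simp add: word_vec_def matrix_vector_mul_assoc matrix_mul_assoc)
qed

lemma word_vec_span_invariant_B3:
  assumes "cyclic_eqs (B1, B2, B3, I, J)"
  shows "invariant_under (vec.span (range (word_vec (B1, B2, I, J)))) B3"
  using word_vec_shift[OF assms] by (auto intro!: invariant_under_span)

lemma stable_cyc_iff: "x \<in> stable_cyc \<longleftrightarrow> cyclic_eqs x \<and> forget x \<in> stable_adhm"
proof (cases x)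
  case (fields B1 B2 B3 I J)
  let ?W = "vec.span (range (word_vec (B1, B2, I, J)))"
  show ?thesis
  proof
    assume x: "x \<in> stable_cyc"
    then have eqs: "cyclic_eqs x"
      by (simp add: fields stable_cyc_def cyclic_eqs_def)
    have "invariant_under ?W B3"
      using eqs by (simp add: fields word_vec_span_invariant_B3)
    moreover have "\<forall>S. csubspace S \<and> invariant_under S B1 \<and> invariant_under S B2 \<and>
        invariant_under S B3 \<and> range ((*v) I) \<subseteq> S \<longrightarrow> S = UNIV"
      using x by (simp add: fields stable_cyc_def)
    ultimately have "?W = UNIV"
      using csubspace_span word_vec_span_invariant range_subset_word_vec_span by blast
    then have "\<forall>S. csubspace S \<and> invariant_under S B1 \<and> invariant_under S B2 \<and>
        range ((*v) I) \<subseteq> S \<longrightarrow> S = UNIV"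
      using word_vec_span_minimal[of _ B1 B2 I J] by blast
    with x have "forget x \<in> stable_adhm"
      by (simp add: fields forget_def stable_cyc_def stable_adhm_def)
    with eqs show "cyclic_eqs x \<and> forget x \<in> stable_adhm" ..
  next
    assume "cyclic_eqs x \<and> forget x \<in> stable_adhm"
    then show "x \<in> stable_cyc"
      by (auto simp: fields forget_def stable_cyc_def stable_adhm_def cyclic_eqs_def)
  qed
qed

lemma forget_stable_cyc: "forget ` stable_cyc \<subseteq> stable_adhm"
  using stable_cyc_iff by blast

section \<open>Recovering B3 continuously from the ADHM datum\<close>

type_synonym ('n, 'r) frame = "'n \<Rightarrow> bool list \<times> (complex^'r)"

definition word_matrix :: "('n::finite,'r::finite) frame \<Rightarrow> ('n,'r) adhm \<Rightarrow> complex^'n^'n"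
  where "word_matrix f a = (\<chi> i c. word_vec a (f c) $ i)"

lemma continuous_on_word_matrix: "continuous_on S (word_matrix f)"
  unfolding word_matrix_def word_vec_def case_prod_unfold
  by (intro continuous_on_vec_lambda continuous_on_component continuous_intros)

lemma stable_adhm_obtains_frame:
  assumes "a \<in> stable_adhm"
  obtains f where "det (word_matrix f a) \<noteq> 0"
  using spanning_family_obtains_invertible_matrix[OF stable_adhm_word_vec_span[OF assms]]
  unfolding word_matrix_def by blast

lemma word_matrix_shift:
  assumes "cyclic_eqs (B1, B2, B3, I, J)"
  shows "B3 ** word_matrix f (B1, B2, I, J) =
    word_matrix (apsnd ((*v) shiftA) \<circ> f) (B1, B2, I, J)"
proof -
  have "(B3 ** word_matrix f (B1, B2, I, J)) $ i $ c = (B3 *v word_vec (B1, B2, I, J) (f c)) $ i"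
    for i c
    by (simp add: word_matrix_def matrix_matrix_mult_def matrix_vector_mult_def)
  then show ?thesis
    using word_vec_shift[OF assms]
    by (simp add: vec_eq_iff word_matrix_def apsnd_def map_prod_def split: prod.split)
qed

definition lift_cyc :: "('n::finite,'r::{finite,linorder}) frame \<Rightarrow> ('n,'r) adhm \<Rightarrow> ('n,'r) cyc"
  where "lift_cyc f a = (case a of (B1, B2, I, J) \<Rightarrow>
    (B1, B2, matrix_right_quotient (word_matrix (apsnd ((*v) shiftA) \<circ> f) a) (word_matrix f a),
     I, J))"

lemma forget_lift_cyc [simp]: "forget (lift_cyc f a) = a"
  by (simp add: lift_cyc_def forget_def split: prod.split)

lemma lift_cyc_forget:
  assumes "cyclic_eqs x" "det (word_matrix f (forget x)) \<noteq> 0"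
  shows "lift_cyc f (forget x) = x"
proof (cases x)
  case (fields B1 B2 B3 I J)
  then have "B3 = matrix_right_quotient (word_matrix (apsnd ((*v) shiftA) \<circ> f) (B1, B2, I, J))
      (word_matrix f (B1, B2, I, J))"
    using assms by (intro matrix_right_quotient_unique word_matrix_shift) (auto simp: forget_def)
  then show ?thesis
    by (simp add: fields lift_cyc_def forget_def)
qed

lemma continuous_on_lift_cyc: "continuous_on {a. det (word_matrix f a) \<noteq> 0} (lift_cyc f)"
  unfolding lift_cyc_def case_prod_unfold
  by (intro continuous_intros continuous_on_word_matrix) auto

lemma inj_on_forget: "inj_on forget stable_cyc"
proof (rule inj_onI)
  fix x y assume xy: "x \<in> stable_cyc" "y \<in> stable_cyc" "forget x = forget y"
  then obtain f where "det (word_matrix f (forget x)) \<noteq> 0"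
    using stable_adhm_obtains_frame stable_cyc_iff by blast
  with xy show "x = y"
    by (metis lift_cyc_forget stable_cyc_iff)
qed

lemma closed_cyclic_eqs: "closed {x :: ('n::finite,'r::{finite,linorder}) cyc. cyclic_eqs x}"
  unfolding cyclic_eqs_def case_prod_unfold
  by (intro closed_Collect_conj closed_Collect_eq continuous_intros)

lemma forget_image_eq_lift_cyc_preimage:
  assumes K: "K = stable_cyc \<inter> C"
    and U: "U = {a \<in> stable_adhm. det (word_matrix f a) \<noteq> 0}"
  shows "U \<inter> forget ` K = U \<inter> lift_cyc f -` (C \<inter> {x. cyclic_eqs x})"
proof (intro equalityI subsetI)
  fix a assume "a \<in> U \<inter> forget ` K"
  then obtain y where "a = forget y" "y \<in> stable_cyc" "y \<in> C" "a \<in> U"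
    using K by blast
  then show "a \<in> U \<inter> lift_cyc f -` (C \<inter> {x. cyclic_eqs x})"
    using U by (simp add: lift_cyc_forget stable_cyc_iff)
next
  fix a assume a: "a \<in> U \<inter> lift_cyc f -` (C \<inter> {x. cyclic_eqs x})"
  then have "lift_cyc f a \<in> K"
    using K U by (simp add: stable_cyc_iff)
  then show "a \<in> U \<inter> forget ` K"
    using a by (metis IntD1 IntI forget_lift_cyc imageI)
qed

lemma closedin_forget_image:
  assumes "closedin (top_of_set stable_cyc) K"
  shows "closedin (top_of_set stable_adhm) (forget ` K)"
proof (rule closedin_if_locally_closedin)
  obtain C where C: "closed C" "K = stable_cyc \<inter> C"
    using assms closedin_closed by metis
  show "forget ` K \<subseteq> topspace (top_of_set stable_adhm)"
    using C(2) forget_stable_cyc by auto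
  fix a assume "a \<in> topspace (top_of_set stable_adhm) - forget ` K"
  then have a: "a \<in> stable_adhm"
    by simp
  then obtain f where f: "det (word_matrix f a) \<noteq> 0"
    by (rule stable_adhm_obtains_frame)
  define U where "U = {a \<in> stable_adhm. det (word_matrix f a) \<noteq> 0}"
  have "openin (top_of_set stable_adhm) U"
    using continuous_openin_preimage_gen[OF continuous_on_det[OF continuous_on_word_matrix],
        of "-{0}"]
    by (simp add: U_def vimage_def Int_def open_Compl)
  moreover have "closedin (top_of_set U) (U \<inter> lift_cyc f -` (C \<inter> {x. cyclic_eqs x}))"
    using C(1) closed_cyclic_eqs
    by (intro continuous_closedin_preimage continuous_on_subset[OF continuous_on_lift_cyc])
      (auto simp: U_def)
  ultimately show "\<exists>U. openin (top_of_set stable_adhm) U \<and> a \<in> U \<and>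
      closedin (subtopology (top_of_set stable_adhm) U) (U \<inter> forget ` K)"
    using a f forget_image_eq_lift_cyc_preimage[OF C(2) U_def]
    by (auto simp: U_def subtopology_subtopology Int_absorb1)
qed

section \<open>GL(V)-orbits\<close>

definition orbit_rel :: "'x set \<Rightarrow> ('a::semiring_1^'n^'n \<Rightarrow> 'a^'n^'n \<Rightarrow> 'x \<Rightarrow> 'x) \<Rightarrow> ('x \<times> 'x) set"
  where "orbit_rel S act =
    {(x, y). x \<in> S \<and> y \<in> S \<and> (\<exists>g h. g ** h = mat 1 \<and> h ** g = mat 1 \<and> y = act g h x)}"

lemma equiv_orbit_rel:
  fixes act :: "'a::semiring_1^'n^'n \<Rightarrow> 'a^'n^'n \<Rightarrow> 'x \<Rightarrow> 'x"
  assumes act_id: "\<And>x. act (mat 1) (mat 1) x = x"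
    and act_comp: "\<And>g h g' h' x. act g' h' (act g h x) = act (g' ** g) (h ** h') x"
  shows "equiv S (orbit_rel S act)"
proof (rule equivI)
  show "orbit_rel S act \<subseteq> S \<times> S"
    by (auto simp: orbit_rel_def)
  show "refl_on S (orbit_rel S act)"
    by (rule refl_onI) (auto simp: orbit_rel_def act_id intro!: exI[of _ "mat 1"])
  show "sym (orbit_rel S act)"
  proof (rule symI)
    fix x y assume "(x, y) \<in> orbit_rel S act"
    then obtain g h where xy: "x \<in> S" "y \<in> S" and gh: "g ** h = mat 1" "h ** g = mat 1"
      and y: "y = act g h x"
      by (auto simp: orbit_rel_def)
    have "x = act h g y"
      using gh by (simp add: y act_comp act_id)
    with xy gh have "y \<in> S \<and> x \<in> S \<and> (\<exists>g h. g ** h = mat 1 \<and> h ** g = mat 1 \<and> x = act g h y)"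
      by blast
    then show "(y, x) \<in> orbit_rel S act"
      by (simp add: orbit_rel_def)
  qed
  show "trans (orbit_rel S act)"
  proof (rule transI)
    fix x y z assume "(x, y) \<in> orbit_rel S act" "(y, z) \<in> orbit_rel S act"
    then obtain g h g' h' where xz: "x \<in> S" "z \<in> S"
      and gh: "g ** h = mat 1" "h ** g = mat 1" and y: "y = act g h x"
      and gh': "g' ** h' = mat 1" "h' ** g' = mat 1" and z: "z = act g' h' y"
      by (auto simp: orbit_rel_def)
    have "X ** g ** h = X" "X ** h' ** g' = X" for X :: "'a^'n^'n"
      using gh(1) gh'(2) by (simp_all flip: matrix_mul_assoc)
    then have "(g' ** g) ** (h ** h') = mat 1" "(h ** h') ** (g' ** g) = mat 1"
      using gh(2) gh'(1) by (simp_all add: matrix_mul_assoc)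
    moreover have "z = act (g' ** g) (h ** h') x"
      by (simp add: z y act_comp)
    ultimately have "x \<in> S \<and> z \<in> S \<and> (\<exists>g h. g ** h = mat 1 \<and> h ** g = mat 1 \<and> z = act g h x)"
      using xz by blast
    then show "(x, z) \<in> orbit_rel S act"
      by (simp add: orbit_rel_def)
  qed
qed

definition act_adhm ::
    "complex^'n^'n \<Rightarrow> complex^'n^'n \<Rightarrow> ('n::finite,'r::finite) adhm \<Rightarrow> ('n,'r) adhm"
  where "act_adhm g h = (\<lambda>(B1, B2, I, J). (g ** B1 ** h, g ** B2 ** h, g ** I, J ** h))"

definition act_cyc ::
    "complex^'n^'n \<Rightarrow> complex^'n^'n \<Rightarrow> ('n::finite,'r::finite) cyc \<Rightarrow> ('n,'r) cyc"
  where "act_cyc g h =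
    (\<lambda>(B1, B2, B3, I, J). (g ** B1 ** h, g ** B2 ** h, g ** B3 ** h, g ** I, J ** h))"

lemma adhm_rel_eq_orbit_rel: "adhm_rel = orbit_rel stable_adhm act_adhm"
  by (auto simp: adhm_rel_def orbit_rel_def act_adhm_def)

lemma cyc_rel_eq_orbit_rel: "cyc_rel = orbit_rel stable_cyc act_cyc"
  by (auto simp: cyc_rel_def orbit_rel_def act_cyc_def)

lemma act_adhm_id: "act_adhm (mat 1) (mat 1) x = x"
  by (cases x) (simp add: act_adhm_def)

lemma act_adhm_act_adhm: "act_adhm g' h' (act_adhm g h x) = act_adhm (g' ** g) (h ** h') x"
  by (cases x) (simp add: act_adhm_def matrix_mul_assoc)

lemma act_cyc_id: "act_cyc (mat 1) (mat 1) x = x"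
  by (cases x) (simp add: act_cyc_def)

lemma act_cyc_act_cyc: "act_cyc g' h' (act_cyc g h x) = act_cyc (g' ** g) (h ** h') x"
  by (cases x) (simp add: act_cyc_def matrix_mul_assoc)

lemma equiv_adhm_rel: "equiv stable_adhm adhm_rel"
  unfolding adhm_rel_eq_orbit_rel using act_adhm_id act_adhm_act_adhm by (rule equiv_orbit_rel)

lemma equiv_cyc_rel: "equiv stable_cyc cyc_rel"
  unfolding cyc_rel_eq_orbit_rel using act_cyc_id act_cyc_act_cyc by (rule equiv_orbit_rel)

lemma forget_act_cyc: "forget (act_cyc g h x) = act_adhm g h (forget x)"
  by (cases x) (simp add: forget_def act_cyc_def act_adhm_def)

lemma cyclic_eqs_act_cyc:
  fixes x :: "('n::finite,'r::{finite,linorder}) cyc"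
  assumes "h ** g = mat 1" "cyclic_eqs x"
  shows "cyclic_eqs (act_cyc g h x)"
proof (cases x)
  case (fields B1 B2 B3 I J)
  have cancel: "X ** h ** g = X" for X :: "complex^'n^'m"
    using assms(1) by (metis matrix_mul_assoc matrix_mul_rid)
  have "J ** B3 = shiftA ** J" "X ** B3 ** I = X ** I ** shiftA"
    "X ** B3 ** B1 = X ** B1 ** B3" "X ** B3 ** B2 = X ** B2 ** B3" for X :: "complex^'n^'n"
    using assms(2) by (simp_all add: fields cyclic_eqs_def flip: matrix_mul_assoc)
  then show ?thesis
    by (simp add: fields cyclic_eqs_def act_cyc_def matrix_mul_assoc cancel)
qed

lemma cyc_rel_imp_adhm_rel:
  assumes "(x, y) \<in> cyc_rel"
  shows "(forget x, forget y) \<in> adhm_rel"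
proof -
  obtain g h where "x \<in> stable_cyc" "y \<in> stable_cyc" "g ** h = mat 1" "h ** g = mat 1"
    and y: "y = act_cyc g h x"
    using assms by (auto simp: cyc_rel_eq_orbit_rel orbit_rel_def)
  moreover have "forget y = act_adhm g h (forget x)"
    by (simp add: y forget_act_cyc)
  ultimately show ?thesis
    using forget_stable_cyc unfolding adhm_rel_eq_orbit_rel orbit_rel_def by blast
qed

lemma adhm_rel_lift:
  assumes x: "x \<in> stable_cyc" and xb: "(forget x, b) \<in> adhm_rel"
  obtains y where "(x, y) \<in> cyc_rel" "forget y = b"
proof -
  obtain g h where gh: "g ** h = mat 1" "h ** g = mat 1" and b: "b = act_adhm g h (forget x)"
    and "b \<in> stable_adhm"
    using xb by (auto simp: adhm_rel_eq_orbit_rel orbit_rel_def)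
  have "cyclic_eqs x"
    using x stable_cyc_iff by blast
  with \<open>b \<in> stable_adhm\<close> have "act_cyc g h x \<in> stable_cyc"
    by (simp add: stable_cyc_iff cyclic_eqs_act_cyc[OF gh(2)] forget_act_cyc flip: b)
  with x gh have "(x, act_cyc g h x) \<in> cyc_rel"
    by (auto simp: cyc_rel_eq_orbit_rel orbit_rel_def)
  then show thesis
    using that by (simp add: b forget_act_cyc)
qed

lemma cyc_rel_iff_adhm_rel:
  assumes "x \<in> stable_cyc" "y \<in> stable_cyc"
  shows "(x, y) \<in> cyc_rel \<longleftrightarrow> (forget x, forget y) \<in> adhm_rel"
proof
  assume "(forget x, forget y) \<in> adhm_rel"
  then obtain z where z: "(x, z) \<in> cyc_rel" "forget z = forget y"
    by (rule adhm_rel_lift[OF assms(1)])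
  then have "z \<in> stable_cyc"
    by (auto simp: cyc_rel_def)
  then have "z = y"
    using z(2) assms(2) inj_on_forget by (auto dest: inj_onD)
  with z(1) show "(x, y) \<in> cyc_rel"
    by simp
qed (rule cyc_rel_imp_adhm_rel)

lemma iota_class:
  assumes "x \<in> stable_cyc"
  shows "iota (cyc_rel `` {x}) = adhm_rel `` {forget x}"
proof
  show "iota (cyc_rel `` {x}) \<subseteq> adhm_rel `` {forget x}"
    unfolding iota_def using cyc_rel_imp_adhm_rel by blast
  show "adhm_rel `` {forget x} \<subseteq> iota (cyc_rel `` {x})"
    unfolding iota_def using adhm_rel_lift[OF assms] by blast
qed

section \<open>Orbit spaces\<close>

lemma Union_quotient_Int:
  assumes "equiv S R" "U \<subseteq> S // R" "V \<subseteq> S // R"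
  shows "\<Union>(U \<inter> V) = \<Union>U \<inter> \<Union>V"
proof
  show "\<Union>U \<inter> \<Union>V \<subseteq> \<Union>(U \<inter> V)"
  proof
    fix x assume "x \<in> \<Union>U \<inter> \<Union>V"
    then obtain X Y where "X \<in> U" "Y \<in> V" "x \<in> X" "x \<in> Y"
      by blast
    moreover from this have "X = Y"
      using quotient_disj[OF assms(1)] assms(2,3) by blast
    ultimately show "x \<in> \<Union>(U \<inter> V)"
      by blast
  qed
qed blast

lemma Union_quotient_Diff:
  assumes "equiv S R" "C \<subseteq> S // R"
  shows "\<Union>(S // R - C) = S - \<Union>C"
proof
  show "\<Union>(S // R - C) \<subseteq> S - \<Union>C"
  proof
    fix x assume "x \<in> \<Union>(S // R - C)"
    then obtain X where X: "X \<in> S // R" "X \<notin> C" "x \<in> X"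
      by blast
    have "x \<notin> Y" if "Y \<in> C" for Y
      using quotient_disj[OF assms(1) X(1), of Y] assms(2) X that by blast
    then show "x \<in> S - \<Union>C"
      using X Union_quotient[OF assms(1)] by blast
  qed
  show "S - \<Union>C \<subseteq> \<Union>(S // R - C)"
    using Union_quotient[OF assms(1)] by blast
qed

lemma openin_quot_top:
  assumes "equiv S R"
  shows "openin (quot_top S R) U \<longleftrightarrow> U \<subseteq> S // R \<and> openin (top_of_set S) (\<Union>U)"
proof -
  have "U \<inter> V \<subseteq> S // R \<and> openin (top_of_set S) (\<Union>(U \<inter> V))"
    if "U \<subseteq> S // R \<and> openin (top_of_set S) (\<Union>U)"
      "V \<subseteq> S // R \<and> openin (top_of_set S) (\<Union>V)" for U V
    using that Union_quotient_Int[OF assms, of U V] by (auto intro: openin_Int)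
  moreover have "\<Union>K \<subseteq> S // R \<and> openin (top_of_set S) (\<Union>(\<Union>K))"
    if "\<forall>U\<in>K. U \<subseteq> S // R \<and> openin (top_of_set S) (\<Union>U)" for K
  proof -
    have "\<Union>(\<Union>K) = \<Union>(Union ` K)"
      by blast
    moreover have "openin (top_of_set S) (\<Union>(Union ` K))"
      using that by (auto intro: openin_Union)
    ultimately show ?thesis
      using that by auto
  qed
  ultimately have "istopology (\<lambda>U. U \<subseteq> S // R \<and> openin (top_of_set S) (\<Union>U))"
    unfolding istopology_def by blast
  then show ?thesis
    by (simp add: quot_top_def)
qed

lemma topspace_quot_top:
  assumes "equiv S R"
  shows "topspace (quot_top S R) = S // R"
proof
  show "topspace (quot_top S R) \<subseteq> S // R"
    unfolding topspace_def using openin_quot_top[OF assms] by blast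
  have "openin (quot_top S R) (S // R)"
    using openin_quot_top[OF assms] Union_quotient[OF assms] by simp
  then show "S // R \<subseteq> topspace (quot_top S R)"
    by (rule openin_subset)
qed

lemma closedin_quot_top:
  assumes "equiv S R"
  shows "closedin (quot_top S R) C \<longleftrightarrow> C \<subseteq> S // R \<and> closedin (top_of_set S) (\<Union>C)"
proof (cases "C \<subseteq> S // R")
  case True
  then have "\<Union>C \<subseteq> S"
    using Union_quotient[OF assms] by blast
  with True show ?thesis
    by (simp add: closedin_def topspace_quot_top[OF assms] openin_quot_top[OF assms]
        Union_quotient_Diff[OF assms])
qed (simp add: closedin_def topspace_quot_top[OF assms])

lemma iota_quotient:
  assumes "c \<in> stable_cyc // cyc_rel"
  shows "iota c \<in> stable_adhm // adhm_rel"
proof -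
  obtain x where x: "x \<in> stable_cyc" "c = cyc_rel `` {x}"
    using assms by (rule quotientE)
  then have "forget x \<in> stable_adhm"
    using forget_stable_cyc by blast
  then show ?thesis
    using x by (simp add: iota_class quotientI)
qed

lemma inj_on_iota: "inj_on iota (stable_cyc // cyc_rel)"
proof (rule inj_onI)
  fix c d assume "c \<in> stable_cyc // cyc_rel" "d \<in> stable_cyc // cyc_rel" and cd: "iota c = iota d"
  then obtain x y where x: "x \<in> stable_cyc" "c = cyc_rel `` {x}"
    and y: "y \<in> stable_cyc" "d = cyc_rel `` {y}"
    by (metis quotientE)
  have "forget x \<in> stable_adhm" "forget y \<in> stable_adhm"
    using x(1) y(1) forget_stable_cyc by blast+
  moreover have "adhm_rel `` {forget x} = adhm_rel `` {forget y}"
    using cd x y by (simp add: iota_class)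
  ultimately have "(forget x, forget y) \<in> adhm_rel"
    using eq_equiv_class_iff[OF equiv_adhm_rel] by blast
  then have "(x, y) \<in> cyc_rel"
    using x(1) y(1) cyc_rel_iff_adhm_rel by blast
  then show "c = d"
    using x(2) y(2) equiv_class_eq[OF equiv_cyc_rel] by simp
qed

lemma closed_map_iota:
  "closed_map (Qmod :: ('n::finite,'r::{finite,linorder}) cyc set topology) Amod iota"
  unfolding closed_map_def
proof (intro allI impI)
  fix C :: "('n,'r) cyc set set"
  assume "closedin Qmod C"
  then have C: "C \<subseteq> stable_cyc // cyc_rel" "closedin (top_of_set stable_cyc) (\<Union>C)"
    by (simp_all add: Qmod_def closedin_quot_top[OF equiv_cyc_rel])
  have "\<Union>(iota ` C) = forget ` \<Union>C"
    by (auto simp: iota_def)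
  then have "closedin (top_of_set stable_adhm) (\<Union>(iota ` C))"
    using closedin_forget_image[OF C(2)] by simp
  moreover have "iota ` C \<subseteq> stable_adhm // adhm_rel"
    using iota_quotient C(1) by blast
  ultimately show "closedin Amod (iota ` C)"
    by (simp add: Amod_def closedin_quot_top[OF equiv_adhm_rel])
qed

theorem lemma3p6:
  shows "proper_map (Qmod :: ('n::finite,'r::{finite,linorder}) cyc set topology)
                    (Amod :: ('n,'r) adhm set topology) iota"
proof (rule closed_injective_imp_proper_map)
  show "closed_map (Qmod :: ('n,'r) cyc set topology) Amod iota"
    by (rule closed_map_iota)
  show "inj_on iota (topspace (Qmod :: ('n,'r) cyc set topology))"
    using inj_on_iota by (simp add: Qmod_def topspace_quot_top[OF equiv_cyc_rel])
qed

end
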